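(* Let $J\subset\mathbb R$ be an interval and let $f,g:J\to\mathbb R$ be smooth functions satisfying $g>0$ and $f'(v)^2+g'(v)^2>0$ for all $v\in J$. Assume that the profile curve $v\mapsto(g(v),0,f(v))$ is an embedding, and define the rotationally symmetric surface about the $z$-axis $$\Sigma=\{(g(v)\cos t,\,g(v)\sin t,\,f(v)):\ v\in J,\ 0\le t<2\pi\}\subset\mathbb H_1 .$$ Let $I\subset\mathbb R$ be an interval and $\mathbf r:I\to\mathbb H_1$ a smooth horizontally regular curve parametrized by horizontal arc length, with adapted frame $\{\mathbf t,\mathbf n,\mathbf b\}$, $p$-curvature $\kappa$ and contact normality $\tau$. Fix $s_0\in I$, put $\theta(s)=\int_{s_0}^s\kappa(t)\,dt$, $A(s)=\int_{s_0}^s\cos\theta(t)\,dt$, $B(s)=\int_{s_0}^s\sin\theta(t)\,dt$, and let $$\begin{aligned}u_1(s)&=(c_1-A(s))\cos\theta(s)+(c_2-B(s))\sin\theta(s),\\ u_2(s)&=-(c_1-A(s))\sin\theta(s)+(c_2-B(s))\cos\theta(s),\\ u_3(s)&=c_3+\int_{s_0}^s\bigl(u_2(t)-\tau(t)\bigr)\,dt,\end{aligned}$$ where the real constants $c_1,c_2,c_3$ are chosen so that $$\mathbf r(s)+u_1(s)\mathbf t(s)+u_2(s)\mathbf n(s)+u_3(s)\mathbf b(s)=\mathbf 0\qquad\text{for all }s\in I.$$ Then $\mathbf r(I)\subset\Sigma$ if and only if there exists a unique function $v:I\to J$ such that $$u_1(s)^2+u_2(s)^2=g(v(s))^2,\qquad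 u_3(s)=-f(v(s))\qquad\text{for all }s\in I.$$
   Context: The Heisenberg group $\mathbb H_1$ is identified with $\mathbb R^3$ through its standard coordinates $(x,y,z)$; left translation by $(x,y,z)$ is $(a,b,c)\mapsto(a+x,b+y,c+z+ya-xb)$. The standard left-invariant frame at $(x,y,z)$ is $\mathring{\mathbf e}_1=(1,0,y)$, $\mathring{\mathbf e}_2=(0,1,-x)$, $\mathbf T=(0,0,1)$, and the contact form is $\Theta=dz+x\,dy-y\,dx$. The metric $\langle\cdot,\cdot\rangle$ is the one making $\{\mathring{\mathbf e}_1,\mathring{\mathbf e}_2,\mathbf T\}$ orthonormal. A smooth curve $\mathbf r=(x,y,z)$ is horizontally regular if $(x')^2+(y')^2\neq0$ everywhere; it is parametrized by horizontal arc length if $(x')^2+(y')^2\equiv1$. For such a parametrization the adapted frame, written in the coordinates of $\mathbb R^3$, is $$\mathbf t=x'\mathring{\mathbf e}_1+y'\mathring{\mathbf e}_2=(x',y',x'y-xy'),\quad \mathbf n=-y'\mathring{\mathbf e}_1+x'\mathring{\mathbf e}_2=(-y',x',-yy'-xx'),\quad \mathbf b=\mathbf T=(0,0,1).$$ The $p$-curvature is $\kappa=\langle\mathbf t',\mathbf n\rangle=x'y''-x''y'$ and the contact normality is $\tau=\Theta(\mathbf r')=xy'-x'y+z'$. Sums of points and adapted-frame vectors are taken componentwise in $\mathbb R^3$ under the identification $\mathbb H_1\simeq\mathbb R^3$. *)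

theory Defs
  imports "HOL-Analysis.Analysis"
begin

subsection \<open>Smooth functions on intervals\<close>

text \<open>
  An interval may be open, closed, half-open or unbounded, but is assumed to be nondegenerate
  (nonempty interior), so that the derivative within the interval, one-sided at an endpoint
  belonging to it, is unique.
\<close>

definition nondegenerate_interval :: "real set \<Rightarrow> bool" where
  "nondegenerate_interval S \<longleftrightarrow> is_interval S \<and> interior S \<noteq> {}"

definition deriv_in :: "real set \<Rightarrow> (real \<Rightarrow> 'a::real_normed_vector) \<Rightarrow> real \<Rightarrow> 'a" where
  "deriv_in S f = (\<lambda>t. vector_derivative f (at t within S))"

definition smooth_on_interval :: "real set \<Rightarrow> (real \<Rightarrow> 'a::real_normed_vector) \<Rightarrow> bool" where
  "smooth_on_interval S f \<longleftrightarrow> (\<forall>k. \<forall>t\<in>S. (deriv_in S ^^ k) f differentiable (at t within S))"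

subsection \<open>The Heisenberg group\<close>

text \<open>
  Points and tangent vectors are both given by their coordinates in \<open>\<real>\<^sup>3\<close>; the first
  argument of a field, form or metric is the base point.
\<close>

type_synonym heis = "real^3"

definition frame1 :: "heis \<Rightarrow> heis" where
  "frame1 p = vector [1, 0, p $ 2]"

definition frame2 :: "heis \<Rightarrow> heis" where
  "frame2 p = vector [0, 1, - p $ 1]"

definition frameT :: "heis \<Rightarrow> heis" where
  "frameT p = vector [0, 0, 1]"

definition contact_form :: "heis \<Rightarrow> heis \<Rightarrow> real" where
  "contact_form p w = w $ 3 + p $ 1 * w $ 2 - p $ 2 * w $ 1"

text \<open>
  At \<open>p\<close> the coordinates of \<open>w\<close> in the left-invariant frame are \<open>w $ 1\<close>, \<open>w $ 2\<close> and
  \<open>contact_form p w\<close>, so this is the metric for which the frame is orthonormal.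
\<close>

definition heis_metric :: "heis \<Rightarrow> heis \<Rightarrow> heis \<Rightarrow> real" where
  "heis_metric p w w' = w $ 1 * w' $ 1 + w $ 2 * w' $ 2 + contact_form p w * contact_form p w'"

lemma frame_expansion:
  "w = w $ 1 *\<^sub>R frame1 p + w $ 2 *\<^sub>R frame2 p + contact_form p w *\<^sub>R frameT p"
  by (simp add: vec_eq_iff forall_3 frame1_def frame2_def frameT_def contact_form_def)

lemma frame_orthonormal:
  "heis_metric p (frame1 p) (frame1 p) = 1"
  "heis_metric p (frame2 p) (frame2 p) = 1"
  "heis_metric p (frameT p) (frameT p) = 1"
  "heis_metric p (frame1 p) (frame2 p) = 0"
  "heis_metric p (frame1 p) (frameT p) = 0"
  "heis_metric p (frame2 p) (frameT p) = 0"
  by (simp_all add: heis_metric_def contact_form_def frame1_def frame2_def frameT_def)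

subsection \<open>Horizontally regular curves\<close>

definition horizontally_regular :: "real set \<Rightarrow> (real \<Rightarrow> heis) \<Rightarrow> bool" where
  "horizontally_regular I r \<longleftrightarrow> (\<forall>s\<in>I. (deriv_in I r s $ 1)\<^sup>2 + (deriv_in I r s $ 2)\<^sup>2 \<noteq> 0)"

definition horizontal_arclength :: "real set \<Rightarrow> (real \<Rightarrow> heis) \<Rightarrow> bool" where
  "horizontal_arclength I r \<longleftrightarrow> (\<forall>s\<in>I. (deriv_in I r s $ 1)\<^sup>2 + (deriv_in I r s $ 2)\<^sup>2 = 1)"

definition tvec :: "real set \<Rightarrow> (real \<Rightarrow> heis) \<Rightarrow> real \<Rightarrow> heis" where
  "tvec I r s = deriv_in I r s $ 1 *\<^sub>R frame1 (r s) + deriv_in I r s $ 2 *\<^sub>R frame2 (r s)"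

definition nvec :: "real set \<Rightarrow> (real \<Rightarrow> heis) \<Rightarrow> real \<Rightarrow> heis" where
  "nvec I r s = - (deriv_in I r s $ 2) *\<^sub>R frame1 (r s) + deriv_in I r s $ 1 *\<^sub>R frame2 (r s)"

definition bvec :: "(real \<Rightarrow> heis) \<Rightarrow> real \<Rightarrow> heis" where
  "bvec r s = frameT (r s)"

definition pcurvature :: "real set \<Rightarrow> (real \<Rightarrow> heis) \<Rightarrow> real \<Rightarrow> real" where
  "pcurvature I r s = heis_metric (r s) (deriv_in I (tvec I r) s) (nvec I r s)"

definition contact_normality :: "real set \<Rightarrow> (real \<Rightarrow> heis) \<Rightarrow> real \<Rightarrow> real" where
  "contact_normality I r s = contact_form (r s) (deriv_in I r s)"

lemma tvec_eq:
  "tvec I r s = vector [deriv_in I r s $ 1, deriv_in I r s $ 2,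
     deriv_in I r s $ 1 * r s $ 2 - r s $ 1 * deriv_in I r s $ 2]"
  by (simp add: tvec_def frame1_def frame2_def vec_eq_iff forall_3)

lemma pcurvature_eq:
  assumes I: "nondegenerate_interval I" and r: "smooth_on_interval I r" and s: "s \<in> I"
  defines "r' \<equiv> deriv_in I r" and "r'' \<equiv> deriv_in I (deriv_in I r)"
  shows "pcurvature I r s = r' s $ 1 * r'' s $ 2 - r'' s $ 1 * r' s $ 2"
proof -
  have nontriv: "at s within I \<noteq> bot"
  proof -
    have "\<not> (\<exists>c. I = {c})"
      using I unfolding nondegenerate_interval_def by auto
    then have "s islimpt I"
      using I s unfolding nondegenerate_interval_def
      by (meson connected_imp_perfect is_interval_connected_1)
    then show ?thesis by (simp add: trivial_limit_within)
  qed
  have d1: "(r has_vector_derivative r' s) (at s within I)"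
    using r s unfolding smooth_on_interval_def r'_def deriv_in_def
    by (metis funpow_0 vector_derivative_works)
  have "(deriv_in I ^^ 1) r differentiable (at s within I)"
    using r s unfolding smooth_on_interval_def by blast
  then have d2: "(r' has_vector_derivative r'' s) (at s within I)"
    by (simp add: r'_def r''_def vector_derivative_works deriv_in_def)
  have comp: "((\<lambda>u. q u $ i) has_real_derivative q' $ i) (at s within I)"
    if "(q has_vector_derivative q') (at s within I)" for q and q' :: heis and i
    using bounded_linear.has_vector_derivative[OF bounded_linear_vec_nth that]
    by (simp add: has_real_derivative_iff_has_vector_derivative)
  let ?t' = "vector [r'' s $ 1, r'' s $ 2, r'' s $ 1 * r s $ 2 - r s $ 1 * r'' s $ 2] :: heis"
  have t_comp: "\<forall>i. ((\<lambda>u. tvec I r u $ i) has_real_derivative ?t' $ i) (at s within I)"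
    unfolding forall_3 tvec_eq r'_def[symmetric]
    by (auto intro!: derivative_eq_intros comp[OF d1] comp[OF d2] simp: algebra_simps)
  have "(tvec I r has_vector_derivative ?t') (at s within I)"
    unfolding has_vector_derivative_def
  proof (subst has_derivative_componentwise_within, intro ballI)
    fix b :: heis assume "b \<in> Basis"
    then obtain i where b: "b = axis i 1" by (auto simp: Basis_vec_def)
    have "((\<lambda>u. tvec I r u $ i) has_derivative (\<lambda>u. u * ?t' $ i)) (at s within I)"
      using t_comp
      by (simp add: has_real_derivative_iff_has_vector_derivative has_vector_derivative_def)
    then show "((\<lambda>u. tvec I r u \<bullet> b) has_derivative (\<lambda>u. (u *\<^sub>R ?t') \<bullet> b)) (at s within I)"
      by (simp add: b inner_axis)
  qed
  then have "deriv_in I (tvec I r) s = ?t'"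
    unfolding deriv_in_def using nontriv
    by (simp add: vector_derivative_within)
  then show ?thesis
    by (simp add: pcurvature_def heis_metric_def contact_form_def nvec_def frame1_def
        frame2_def r'_def algebra_simps)
qed

subsection \<open>Moving frame coordinates\<close>

text \<open>
  The integrals are oriented: for \<open>s < s\<^sub>0\<close> the interval integral from \<open>s\<^sub>0\<close> to \<open>s\<close> is minus
  the one from \<open>s\<close> to \<open>s\<^sub>0\<close>.
\<close>

definition turning_angle :: "real set \<Rightarrow> (real \<Rightarrow> heis) \<Rightarrow> real \<Rightarrow> real \<Rightarrow> real" where
  "turning_angle I r s0 s = (LBINT t=ereal s0..ereal s. pcurvature I r t)"

definition cos_integral :: "real set \<Rightarrow> (real \<Rightarrow> heis) \<Rightarrow> real \<Rightarrow> real \<Rightarrow> real" where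
  "cos_integral I r s0 s = (LBINT t=ereal s0..ereal s. cos (turning_angle I r s0 t))"

definition sin_integral :: "real set \<Rightarrow> (real \<Rightarrow> heis) \<Rightarrow> real \<Rightarrow> real \<Rightarrow> real" where
  "sin_integral I r s0 s = (LBINT t=ereal s0..ereal s. sin (turning_angle I r s0 t))"

definition coord1 ::
  "real set \<Rightarrow> (real \<Rightarrow> heis) \<Rightarrow> real \<Rightarrow> real \<Rightarrow> real \<Rightarrow> real \<Rightarrow> real" where
  "coord1 I r s0 c1 c2 s =
     (c1 - cos_integral I r s0 s) * cos (turning_angle I r s0 s)
     + (c2 - sin_integral I r s0 s) * sin (turning_angle I r s0 s)"

definition coord2 ::
  "real set \<Rightarrow> (real \<Rightarrow> heis) \<Rightarrow> real \<Rightarrow> real \<Rightarrow> real \<Rightarrow> real \<Rightarrow> real" where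
  "coord2 I r s0 c1 c2 s =
     - (c1 - cos_integral I r s0 s) * sin (turning_angle I r s0 s)
     + (c2 - sin_integral I r s0 s) * cos (turning_angle I r s0 s)"

definition coord3 ::
  "real set \<Rightarrow> (real \<Rightarrow> heis) \<Rightarrow> real \<Rightarrow> real \<Rightarrow> real \<Rightarrow> real \<Rightarrow> real \<Rightarrow> real" where
  "coord3 I r s0 c1 c2 c3 s =
     c3 + (LBINT t=ereal s0..ereal s. coord2 I r s0 c1 c2 t - contact_normality I r t)"

subsection \<open>Rotationally symmetric surfaces\<close>

definition profile_curve :: "(real \<Rightarrow> real) \<Rightarrow> (real \<Rightarrow> real) \<Rightarrow> real \<Rightarrow> heis" where
  "profile_curve f g v = vector [g v, 0, f v]"

definition rotational_surface ::
  "real set \<Rightarrow> (real \<Rightarrow> real) \<Rightarrow> (real \<Rightarrow> real) \<Rightarrow> heis set" where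
  "rotational_surface J f g =
     {vector [g v * cos t, g v * sin t, f v] | v t. v \<in> J \<and> 0 \<le> t \<and> t < 2 * pi}"

end

theory Submission
  imports Defs
begin

text \<open>
  Solving the componentwise identity \<open>r + u1 t + u2 n + u3 b = 0\<close> for \<open>r\<close> shows that
  \<open>u1\<^sup>2 + u2\<^sup>2\<close> is the squared distance of \<open>r s\<close> to the \<open>z\<close>-axis and that \<open>- u3\<close> is its height.
  So \<open>r s\<close> lies on the surface iff some \<open>v\<close> in \<open>J\<close> satisfies the two equations at \<open>s\<close>, and
  injectivity of the profile curve makes this \<open>v\<close> unique.
\<close>

text \<open>Unit horizontal speed makes the planar parts of \<open>tvec\<close> and
  \<open>nvec\<close> an orthonormal basis, so the planar part of \<open>r s\<close> is the image of
  \<open>(- u1, - u2)\<close> under a rotation and has the same length.\<close>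

lemma frame_coordinates_radius_height:
  assumes unit: "(deriv_in I r s $ 1)\<^sup>2 + (deriv_in I r s $ 2)\<^sup>2 = 1"
    and zero: "r s + u1 *\<^sub>R tvec I r s + u2 *\<^sub>R nvec I r s + u3 *\<^sub>R bvec r s = 0"
  shows "(r s $ 1)\<^sup>2 + (r s $ 2)\<^sup>2 = u1\<^sup>2 + u2\<^sup>2" "r s $ 3 = - u3"
proof -
  define a b where "a = deriv_in I r s $ 1" and "b = deriv_in I r s $ 2"
  have eqs: "r s $ 1 + u1 * a - u2 * b = 0" "r s $ 2 + u1 * b + u2 * a = 0"
    "r s $ 3 + u1 * (a * r s $ 2 - b * r s $ 1) - u2 * (b * r s $ 2 + a * r s $ 1) + u3 = 0"
    using zero unfolding vec_eq_iff forall_3 tvec_def nvec_def bvec_def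
      frame1_def frame2_def frameT_def a_def b_def
    by (simp_all add: algebra_simps)
  have x: "r s $ 1 = u2 * b - u1 * a" and y: "r s $ 2 = - u1 * b - u2 * a"
    using eqs by simp_all
  have "(r s $ 1)\<^sup>2 + (r s $ 2)\<^sup>2 = (u1\<^sup>2 + u2\<^sup>2) * (a\<^sup>2 + b\<^sup>2)"
    unfolding x y by (simp add: power2_eq_square algebra_simps)
  then show "(r s $ 1)\<^sup>2 + (r s $ 2)\<^sup>2 = u1\<^sup>2 + u2\<^sup>2"
    using unit by (simp add: a_def b_def)
  \<comment> \<open>The vector \<open>u1 t + u2 n\<close> is horizontal at
    \<open>r s = (x, y, z)\<close> with planar part \<open>(- x, - y)\<close>, so its third
    coordinate is \<open>(- x) y - x (- y) = 0\<close>, and only \<open>u3\<close> offsets the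
    height.\<close>
  show "r s $ 3 = - u3"
    using eqs(3) unfolding x y by (simp add: algebra_simps)
qed

text \<open>This eliminates the angle: since \<open>g v > 0\<close>, dividing by \<open>g v\<close>
  puts the planar part of \<open>p\<close> on the unit circle, where some angle in
  \<open>[0, 2 pi)\<close> describes it.\<close>

lemma rotational_surface_iff:
  assumes g_pos: "\<And>v. v \<in> J \<Longrightarrow> g v > 0"
  shows "p \<in> rotational_surface J f g \<longleftrightarrow>
    (\<exists>v\<in>J. (p $ 1)\<^sup>2 + (p $ 2)\<^sup>2 = (g v)\<^sup>2 \<and> p $ 3 = f v)"
proof
  assume "p \<in> rotational_surface J f g"
  then obtain v t where "v \<in> J" "p = vector [g v * cos t, g v * sin t, f v]"
    unfolding rotational_surface_def by blast
  moreover have "(g v * cos t)\<^sup>2 + (g v * sin t)\<^sup>2 = (g v)\<^sup>2"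
    by (simp add: power_mult_distrib flip: distrib_left)
  ultimately show "\<exists>v\<in>J. (p $ 1)\<^sup>2 + (p $ 2)\<^sup>2 = (g v)\<^sup>2 \<and> p $ 3 = f v"
    by auto
next
  assume "\<exists>v\<in>J. (p $ 1)\<^sup>2 + (p $ 2)\<^sup>2 = (g v)\<^sup>2 \<and> p $ 3 = f v"
  then obtain v where v: "v \<in> J" "(p $ 1)\<^sup>2 + (p $ 2)\<^sup>2 = (g v)\<^sup>2" "p $ 3 = f v"
    by blast
  have g0: "g v > 0" using g_pos v(1) .
  have "(p $ 1 / g v)\<^sup>2 + (p $ 2 / g v)\<^sup>2 = 1"
    using g0 v(2) by (simp add: power_divide flip: add_divide_distrib)
  then obtain t where "0 \<le> t" "t < 2 * pi" "p $ 1 / g v = cos t" "p $ 2 / g v = sin t"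
    by (metis sincos_total_2pi)
  then have "p = vector [g v * cos t, g v * sin t, f v]"
    using g0 v(3) by (simp add: vec_eq_iff forall_3 field_simps)
  with v(1) \<open>0 \<le> t\<close> \<open>t < 2 * pi\<close> show "p \<in> rotational_surface J f g"
    unfolding rotational_surface_def by blast
qed

text \<open>No regularity is asked of the function, so choosing a value at each point of
  \<open>I\<close> suffices; pointwise uniqueness then forces agreement on \<open>I\<close>.\<close>

lemma Ex1_PiE_iff:
  assumes "\<And>s v w. \<lbrakk>s \<in> I; v \<in> J; w \<in> J; P s v; P s w\<rbrakk> \<Longrightarrow> v = w"
  shows "(\<exists>!v. v \<in> I \<rightarrow>\<^sub>E J \<and> (\<forall>s\<in>I. P s (v s))) \<longleftrightarrow> (\<forall>s\<in>I. \<exists>w\<in>J. P s w)"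
proof
  assume "\<exists>!v. v \<in> I \<rightarrow>\<^sub>E J \<and> (\<forall>s\<in>I. P s (v s))"
  then show "\<forall>s\<in>I. \<exists>w\<in>J. P s w" by (metis PiE_mem)
next
  assume "\<forall>s\<in>I. \<exists>w\<in>J. P s w"
  then obtain w where w: "\<And>s. s \<in> I \<Longrightarrow> w s \<in> J \<and> P s (w s)"
    by metis
  show "\<exists>!v. v \<in> I \<rightarrow>\<^sub>E J \<and> (\<forall>s\<in>I. P s (v s))"
  \<comment> \<open>Restriction makes the chosen function \<open>undefined\<close> off
    \<open>I\<close>, as for every member of \<open>I \<rightarrow>\<^sub>E J\<close>, so no second
    solution can differ there.\<close>
  proof (rule ex1I[where a = "restrict w I"])
    fix v assume v: "v \<in> I \<rightarrow>\<^sub>E J \<and> (\<forall>s\<in>I. P s (v s))"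
    show "v = restrict w I"
      using v w assms by (intro extensionalityI[where A = I]) (auto simp: PiE_def Pi_iff)
  qed (use w in auto)
qed

theorem theorem3p2:
  fixes J I :: "real set"
    and f g :: "real \<Rightarrow> real"
    and r :: "real \<Rightarrow> heis"
    and s0 c1 c2 c3 :: real
  assumes J: "nondegenerate_interval J"
    and f_smooth: "smooth_on_interval J f"
    and g_smooth: "smooth_on_interval J g"
    and g_pos: "\<And>v. v \<in> J \<Longrightarrow> g v > 0"
    and regular_profile: "\<And>v. v \<in> J \<Longrightarrow> (deriv_in J f v)\<^sup>2 + (deriv_in J g v)\<^sup>2 > 0"
    and embedding: "embedding_map (top_of_set J) euclidean (profile_curve f g)"
    and I: "nondegenerate_interval I"
    and r_smooth: "smooth_on_interval I r"
    and r_regular: "horizontally_regular I r"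
    and r_arclength: "horizontal_arclength I r"
    and s0: "s0 \<in> I"
    and constants: "\<And>s. s \<in> I \<Longrightarrow>
      r s + coord1 I r s0 c1 c2 s *\<^sub>R tvec I r s + coord2 I r s0 c1 c2 s *\<^sub>R nvec I r s
        + coord3 I r s0 c1 c2 c3 s *\<^sub>R bvec r s = 0"
  shows "r ` I \<subseteq> rotational_surface J f g \<longleftrightarrow>
    (\<exists>!v. v \<in> I \<rightarrow>\<^sub>E J \<and>
       (\<forall>s\<in>I. (coord1 I r s0 c1 c2 s)\<^sup>2 + (coord2 I r s0 c1 c2 s)\<^sup>2 = (g (v s))\<^sup>2
          \<and> coord3 I r s0 c1 c2 c3 s = - f (v s)))"
proof -
  let ?u1 = "coord1 I r s0 c1 c2" and ?u2 = "coord2 I r s0 c1 c2"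
    and ?u3 = "coord3 I r s0 c1 c2 c3"
  have profile_inj: "inj_on (profile_curve f g) J"
    using embedding
    by (auto simp: embedding_map_def homeomorphic_eq_everything_map)
  have unique: "v = w"
    if "v \<in> J" "w \<in> J" "(?u1 s)\<^sup>2 + (?u2 s)\<^sup>2 = (g v)\<^sup>2 \<and> ?u3 s = - f v"
      "(?u1 s)\<^sup>2 + (?u2 s)\<^sup>2 = (g w)\<^sup>2 \<and> ?u3 s = - f w" for s v w
  proof -
    \<comment> \<open>Positivity of \<open>g\<close> selects the same square root of
      \<open>u1\<^sup>2 + u2\<^sup>2\<close> for both parameters.\<close>
    have "g v = g w" "f v = f w"
      using that g_pos[of v] g_pos[of w] by (auto simp: power2_eq_iff_nonneg)
    then have "profile_curve f g v = profile_curve f g w"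
      by (simp add: profile_curve_def)
    with profile_inj that(1,2) show ?thesis by (auto dest: inj_onD)
  qed
  have "r s \<in> rotational_surface J f g \<longleftrightarrow>
      (\<exists>w\<in>J. (?u1 s)\<^sup>2 + (?u2 s)\<^sup>2 = (g w)\<^sup>2 \<and> ?u3 s = - f w)" if "s \<in> I" for s
  proof -
    have "(deriv_in I r s $ 1)\<^sup>2 + (deriv_in I r s $ 2)\<^sup>2 = 1"
      using r_arclength that unfolding horizontal_arclength_def by blast
    from frame_coordinates_radius_height[OF this constants[OF that]]
    \<comment> \<open>The surface condition gives \<open>- u3 = f w\<close>; it remains to move the
      sign to the other side.\<close>
    show ?thesis
      by (auto simp: rotational_surface_iff g_pos equation_minus_iff)
  qed
  then have "r ` I \<subseteq> rotational_surface J f g \<longleftrightarrow>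
      (\<forall>s\<in>I. \<exists>w\<in>J. (?u1 s)\<^sup>2 + (?u2 s)\<^sup>2 = (g w)\<^sup>2 \<and> ?u3 s = - f w)"
    by auto
  also have "\<dots> \<longleftrightarrow> (\<exists>!v. v \<in> I \<rightarrow>\<^sub>E J \<and>
      (\<forall>s\<in>I. (?u1 s)\<^sup>2 + (?u2 s)\<^sup>2 = (g (v s))\<^sup>2 \<and> ?u3 s = - f (v s)))"
    by (rule Ex1_PiE_iff[symmetric]) (rule unique)
  finally show ?thesis .
qed

end
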